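(* Let $\mu\ge 0$ and let $R$ be a BESQ$(\mu)$. Let $t>0$ and $y=1$. If $R(0)=1$, then $$\mathbb{P}(\tau_1\le t\,|\,R(t)=x)=1\qquad\text{for } x\ge 1.$$
   Context: BESQ$(\mu)$ denotes the squared Bessel process with index $\mu\ge 0$ (dimension $\delta=2(\mu+1)$), i.e. the nonnegative continuous process solving $dR(t)=2\sqrt{R(t)}\,dB_t+\delta\,dt$ with $B$ a standard Brownian motion. $\tau_y=\inf\{u>0:R(u)=y\}$ is the first hitting time of $y$ by $R$. *)

theory Defs
  imports "HOL-Probability.Probability"
begin

text \<open>
  Processes are indexed by the nonnegative reals, represented by functions on \<open>real\<close> of which only
  the restriction to \<open>{0..}\<close> is constrained. A filtration is a real-indexed library \<open>filtration\<close>;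
  its members at negative times are irrelevant (one may take \<open>F s = F 0\<close> for \<open>s < 0\<close>).
\<close>

context prob_space
begin

definition standard_brownian_motion ::
    "(real \<Rightarrow> 'a measure) \<Rightarrow> (real \<Rightarrow> 'a \<Rightarrow> real) \<Rightarrow> bool" where
  "standard_brownian_motion F B \<longleftrightarrow>
     filtration (space M) F \<and> (\<forall>s\<ge>0. subalgebra M (F s)) \<and>
     (\<forall>s\<ge>0. B s \<in> borel_measurable (F s)) \<and>
     (\<forall>\<omega>\<in>space M. B 0 \<omega> = 0 \<and> continuous_on {0..} (\<lambda>s. B s \<omega>)) \<and>
     (\<forall>s u. 0 \<le> s \<longrightarrow> s < u \<longrightarrow>
        distributed M lborel (\<lambda>\<omega>. B u \<omega> - B s \<omega>) (normal_density 0 (sqrt (u - s))) \<and>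
        indep_set (sets (F s)) (sets (vimage_algebra (space M) (\<lambda>\<omega>. B u \<omega> - B s \<omega>) borel)))"

definition tendsto_in_prob :: "(nat \<Rightarrow> 'a \<Rightarrow> real) \<Rightarrow> ('a \<Rightarrow> real) \<Rightarrow> bool" where
  "tendsto_in_prob X Y \<longleftrightarrow>
     (\<forall>k. X k \<in> borel_measurable M) \<and> Y \<in> borel_measurable M \<and>
     (\<forall>e>0. (\<lambda>k. prob {\<omega>\<in>space M. e < \<bar>X k \<omega> - Y \<omega>\<bar>}) \<longlonglongrightarrow> 0)"

text \<open>
  \<open>simple_process F t n p \<xi>\<close> describes the simple process with value \<open>\<xi> i\<close> on \<open>{p i<..p (Suc i)}\<close>,
  \<open>i < n\<close>, where \<open>0 = p 0 \<le> \<dots> \<le> p n = t\<close>.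
\<close>

definition simple_process ::
    "(real \<Rightarrow> 'a measure) \<Rightarrow> real \<Rightarrow> nat \<Rightarrow> (nat \<Rightarrow> real) \<Rightarrow> (nat \<Rightarrow> 'a \<Rightarrow> real) \<Rightarrow> bool" where
  "simple_process F t n p \<xi> \<longleftrightarrow>
     p 0 = 0 \<and> p n = t \<and>
     (\<forall>i<n. p i \<le> p (Suc i) \<and> \<xi> i \<in> borel_measurable (F (p i)) \<and>
            (\<exists>K. \<forall>\<omega>\<in>space M. \<bar>\<xi> i \<omega>\<bar> \<le> K))"

definition simple_value ::
    "nat \<Rightarrow> (nat \<Rightarrow> real) \<Rightarrow> (nat \<Rightarrow> 'a \<Rightarrow> real) \<Rightarrow> real \<Rightarrow> 'a \<Rightarrow> real" where
  "simple_value n p \<xi> s \<omega> = (\<Sum>i<n. \<xi> i \<omega> * indicator {p i<..p (Suc i)} s)"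

definition simple_integral ::
    "(real \<Rightarrow> 'a \<Rightarrow> real) \<Rightarrow> nat \<Rightarrow> (nat \<Rightarrow> real) \<Rightarrow> (nat \<Rightarrow> 'a \<Rightarrow> real) \<Rightarrow> 'a \<Rightarrow> real" where
  "simple_integral B n p \<xi> \<omega> = (\<Sum>i<n. \<xi> i \<omega> * (B (p (Suc i)) \<omega> - B (p i) \<omega>))"

text \<open>
  \<open>has_ito_integral F B H t J\<close>: almost surely \<open>J = \<integral>\<^sub>0\<^sup>t H dB\<close>, the Ito integral of an
  integrand with almost surely square integrable paths, i.e. the limit in probability of the
  integrals of simple processes \<open>H\<^sub>k\<close> with \<open>\<integral>\<^sub>0\<^sup>t (H\<^sub>k - H)\<^sup>2 ds \<longlonglongrightarrow> 0\<close> in probability.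
  (The limit does not depend on the approximating sequence.) The pathwise integrals
  are taken in \<open>ennreal\<close>, so a path that is not square integrable gives \<open>\<infinity>\<close>, not \<open>0\<close>.
\<close>

definition has_ito_integral ::
    "(real \<Rightarrow> 'a measure) \<Rightarrow> (real \<Rightarrow> 'a \<Rightarrow> real) \<Rightarrow> (real \<Rightarrow> 'a \<Rightarrow> real) \<Rightarrow> real \<Rightarrow> ('a \<Rightarrow> real) \<Rightarrow> bool"
where
  "has_ito_integral F B H t J \<longleftrightarrow>
     (\<forall>u\<in>{0..t}. (\<lambda>(s, \<omega>). H s \<omega>) \<in> borel_measurable (restrict_space borel {0..u} \<Otimes>\<^sub>M F u)) \<and>
     (\<exists>n p \<xi>.
        (\<forall>k. simple_process F t (n k) (p k) (\<xi> k)) \<and>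
        (\<forall>e>0. (\<lambda>k. prob {\<omega>\<in>space M. ennreal e <
             (\<integral>\<^sup>+s\<in>{0..t}. ennreal ((simple_value (n k) (p k) (\<xi> k) s \<omega> - H s \<omega>)\<^sup>2) \<partial>lborel)})
           \<longlonglongrightarrow> 0) \<and>
        tendsto_in_prob (\<lambda>k. simple_integral B (n k) (p k) (\<xi> k)) J)"

text \<open>
  BESQ(\<open>\<mu>\<close>) as a weak solution of \<open>dR = 2 \<surd>R dB + \<delta> dt\<close> with \<open>\<delta> = 2 (\<mu> + 1)\<close>, written in its
  integral form. The initial value is left free.
\<close>

definition squared_bessel :: "real \<Rightarrow> (real \<Rightarrow> 'a \<Rightarrow> real) \<Rightarrow> bool" where
  "squared_bessel \<mu> R \<longleftrightarrow>
     (\<exists>F B. standard_brownian_motion F B \<and>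
        (\<forall>s\<ge>0. R s \<in> borel_measurable (F s)) \<and>
        (\<forall>\<omega>\<in>space M. continuous_on {0..} (\<lambda>s. R s \<omega>) \<and> (\<forall>s\<ge>0. 0 \<le> R s \<omega>)) \<and>
        (\<forall>t\<ge>0. has_ito_integral F B (\<lambda>s \<omega>. 2 * sqrt (R s \<omega>)) t
                  (\<lambda>\<omega>. R t \<omega> - R 0 \<omega> - 2 * (\<mu> + 1) * t)))"

text \<open>
  \<open>cond_prob_version A X g\<close>: the function \<open>g\<close> is a version of \<open>x \<mapsto> P(A | X = x)\<close>, that is,
  \<open>P(A | \<sigma>(X)) = g(X)\<close> almost surely. Such a \<open>g\<close> is determined up to null sets of the law of \<open>X\<close>.
\<close>

definition cond_prob_version :: "'a set \<Rightarrow> ('a \<Rightarrow> real) \<Rightarrow> (real \<Rightarrow> real) \<Rightarrow> bool" where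
  "cond_prob_version A X g \<longleftrightarrow>
     g \<in> borel_measurable borel \<and>
     (AE \<omega> in M. real_cond_exp M (vimage_algebra (space M) X borel) (indicator A) \<omega> = g (X \<omega>))"

text \<open>
  \<open>has_cond_prob_at A X x q\<close>: at the individual point \<open>x\<close>, \<open>P(A | X = x) = q\<close> in the sense
  \<open>P(A, X \<in> dx) = q P(X \<in> dx)\<close>, i.e. \<open>P(A, \<bar>X - x\<bar> < r) = (q + o(1)) P(\<bar>X - x\<bar> < r)\<close> as \<open>r\<close>
  tends to \<open>0\<close>. At points of the support of the law of \<open>X\<close> this says that \<open>P(A | \<bar>X - x\<bar> < r)\<close>
  tends to \<open>q\<close>, so \<open>q\<close> is unique. For BESQ(\<open>\<mu>\<close>), \<open>\<mu> \<ge> 0\<close>, at a time \<open>t > 0\<close>, every \<open>x > 0\<close>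
  is such a point, since \<open>R t\<close> has a density that is positive and continuous on \<open>{0<..}\<close>.
\<close>

definition has_cond_prob_at :: "'a set \<Rightarrow> ('a \<Rightarrow> real) \<Rightarrow> real \<Rightarrow> real \<Rightarrow> bool" where
  "has_cond_prob_at A X x q \<longleftrightarrow>
     (\<forall>e>0. \<forall>\<^sub>F r in at_right 0.
        \<bar>prob {\<omega>\<in>A. \<bar>X \<omega> - x\<bar> < r} - q * prob {\<omega>\<in>space M. \<bar>X \<omega> - x\<bar> < r}\<bar>
          \<le> e * prob {\<omega>\<in>space M. \<bar>X \<omega> - x\<bar> < r})"

end

text \<open>The first hitting time of \<open>y\<close> after time \<open>0\<close>; it is \<open>\<infinity>\<close> if \<open>y\<close> is never hit.\<close>

definition hitting_time :: "(real \<Rightarrow> 'a \<Rightarrow> real) \<Rightarrow> real \<Rightarrow> 'a \<Rightarrow> ereal" where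
  "hitting_time R y \<omega> = Inf {ereal u | u. 0 < u \<and> R u \<omega> = y}"

end

theory Submission
  imports Defs
begin

text \<open>
  The conditioning is a red herring: the event itself has probability one. A process started at \<open>1\<close>
  returns to \<open>1\<close> at arbitrarily small positive times, almost surely, so \<open>\<tau>\<^sub>1 = 0\<close>, and an almost sure
  event has conditional probability \<open>1\<close> given anything.

  If a continuous path does not visit \<open>1\<close> in \<open>{0<..t}\<close>, it stays on one side of \<open>1\<close> there. For a sign
  \<open>\<sigma>\<close>, let \<open>G\<close> be the event that \<open>\<sigma> (R - 1) \<ge> 0\<close> on some interval \<open>{0..1/n}\<close>; it remains to show that
  \<open>G\<close> is null (\<open>besq_one_sided_null\<close>). For small \<open>s\<close> the equation reads
  \<open>R\<^sub>s - 1 = 2 B\<^sub>s + \<integral>\<^sub>0\<^sup>s (2 \<surd>R - 2) dB + \<delta> s\<close>.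
  The drift is \<open>O(s)\<close>, and the integral is \<open>o(\<surd>s)\<close> in probability since its integrand tends to \<open>0\<close>
  (\<open>sqrt_diffusion_small_time_approximation\<close>), so \<open>2 B\<^sub>s\<close>, of order \<open>\<surd>s\<close>, decides the sign.
  The event \<open>G\<close> depends only on the path just after time \<open>0\<close>, hence belongs to \<open>F r\<close> for every
  \<open>r > 0\<close>; with \<open>r = s\<^sup>2\<close> it is independent of \<open>B\<^sub>s - B\<^sub>r\<close>, while \<open>B\<^sub>r\<close> is negligible against \<open>\<surd>s\<close>.
  So, up to \<open>o(1)\<close>, the event that \<open>G\<close> holds and \<open>\<sigma> (R\<^sub>s - 1) < 0\<close> has at least the probability \<open>c P(G)\<close>,
  where \<open>c > 0\<close> is a Gaussian tail. On \<open>G\<close>, however, \<open>\<sigma> (R\<^sub>s - 1) \<ge> 0\<close> for all small \<open>s\<close>, so that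
  probability tends to \<open>0\<close>, and \<open>P(G) = 0\<close>.

  The bound on the stochastic integral is the inequality
  \<open>P(\<bar>\<integral> H dB\<bar> > a) \<le> b / a\<^sup>2 + P(\<integral> H\<^sup>2 ds > b)\<close>, proved for simple processes by stopping them before
  the energy \<open>\<integral> H\<^sup>2 ds\<close> exceeds \<open>b\<close> (\<open>simple_integral_tail\<close>) and carried over to the limit
  (\<open>ito_integral_near_constant\<close>).
\<close>

section \<open>Path events and the hitting time\<close>

text \<open>
  By continuity it is enough to test the condition on a countable dense subset of \<open>S\<close>. The measure
  space is arbitrary so that the lemma also places events of the path up to time \<open>s\<close> in \<open>F s\<close>.
\<close>
lemma sets_all_in_closed:
  fixes X :: "real \<Rightarrow> 'a \<Rightarrow> 'b::second_countable_topology"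
  assumes meas: "\<And>u. u \<in> S \<Longrightarrow> X u \<in> borel_measurable N"
    and cont: "\<And>\<omega>. \<omega> \<in> space N \<Longrightarrow> continuous_on S (\<lambda>u. X u \<omega>)"
    and "closed C"
  shows "{\<omega>\<in>space N. \<forall>u\<in>S. X u \<omega> \<in> C} \<in> sets N"
proof -
  obtain T where T: "countable T" "T \<subseteq> S" "S \<subseteq> closure T"
    using separable by blast
  have "X u \<omega> \<in> C" if "\<omega> \<in> space N" "\<forall>u\<in>T. X u \<omega> \<in> C" "u \<in> S" for u \<omega>
  proof -
    have "closedin (top_of_set S) (S \<inter> (\<lambda>u. X u \<omega>) -` C)"
      by (intro continuous_closedin_preimage cont that \<open>closed C\<close>)
    then obtain K where K: "closed K" "S \<inter> (\<lambda>u. X u \<omega>) -` C = S \<inter> K"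
      by (auto simp: closedin_closed)
    have "T \<subseteq> K" using K that(2) T(2) by auto
    then show ?thesis using K T(3) closure_minimal[of T K] that(3) by auto
  qed
  then have "{\<omega>\<in>space N. \<forall>u\<in>S. X u \<omega> \<in> C} = {\<omega>\<in>space N. \<forall>u\<in>T. X u \<omega> \<in> C}"
    using T(2) by auto
  also have "\<dots> = space N - (\<Union>u\<in>T. {\<omega>\<in>space N. X u \<omega> \<notin> C})" by auto
  also have "\<dots> \<in> sets N"
  proof (intro sets.Diff sets.top sets.countable_UN'[OF T(1)] image_subsetI)
    fix u assume "u \<in> T"
    then have [measurable]: "X u \<in> borel_measurable N" using T meas by auto
    have [measurable]: "C \<in> sets borel" using \<open>closed C\<close> by auto
    show "{\<omega>\<in>space N. X u \<omega> \<notin> C} \<in> sets N" by measurable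
  qed
  finally show ?thesis .
qed

text \<open>
  A continuous path that misses \<open>y\<close> on a compact interval stays at a positive distance from it, so the
  complement is a countable union of closed conditions.
\<close>
lemma sets_hits_value:
  fixes X :: "real \<Rightarrow> 'a \<Rightarrow> real"
  assumes meas: "\<And>u. u \<in> {a..b} \<Longrightarrow> X u \<in> borel_measurable N"
    and cont: "\<And>\<omega>. \<omega> \<in> space N \<Longrightarrow> continuous_on {a..b} (\<lambda>u. X u \<omega>)"
  shows "{\<omega>\<in>space N. \<exists>u\<in>{a..b}. X u \<omega> = y} \<in> sets N"
proof -
  define Away where "Away n = {\<omega>\<in>space N. \<forall>u\<in>{a..b}. X u \<omega> \<in> {z. 1 / real (Suc n) \<le> \<bar>z - y\<bar>}}" for n
  have "Away n \<in> sets N" for n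
    unfolding Away_def
    by (intro sets_all_in_closed meas cont closed_Collect_le continuous_intros) auto
  moreover have "{\<omega>\<in>space N. \<exists>u\<in>{a..b}. X u \<omega> = y} = space N - (\<Union>n. Away n)"
  proof -
    have "\<exists>n. \<omega> \<in> Away n" if \<omega>: "\<omega> \<in> space N" and no: "\<forall>u\<in>{a..b}. X u \<omega> \<noteq> y" for \<omega>
    proof (cases "{a..b} = {}")
      case True
      then show ?thesis using \<omega> by (auto simp: Away_def)
    next
      case False
      have "continuous_on {a..b} (\<lambda>u. \<bar>X u \<omega> - y\<bar>)"
        by (intro continuous_intros cont \<omega>)
      from continuous_attains_inf[OF compact_Icc False this]
      obtain v where v: "v \<in> {a..b}" "\<And>u. u \<in> {a..b} \<Longrightarrow> \<bar>X v \<omega> - y\<bar> \<le> \<bar>X u \<omega> - y\<bar>" by auto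
      have "0 < \<bar>X v \<omega> - y\<bar>" using no v(1) by simp
      then obtain n where "inverse (real (Suc n)) < \<bar>X v \<omega> - y\<bar>"
        using reals_Archimedean by blast
      then have "1 / real (Suc n) \<le> \<bar>X u \<omega> - y\<bar>" if "u \<in> {a..b}" for u
        using v(2)[OF that] by (simp add: inverse_eq_divide)
      then show ?thesis using \<omega> unfolding Away_def by blast
    qed
    then show ?thesis by (force simp: Away_def)
  qed
  ultimately show ?thesis by auto
qed

text \<open>
  If the infimum is \<open>0\<close>, there are visits at arbitrarily small positive times; if it is positive, it is
  attained. Either way there is a visit in \<open>{0<..t}\<close>, and intervals bounded away from \<open>0\<close> make
  the event a countable union of measurable ones.
\<close>
lemma hitting_time_le_iff:
  assumes cont: "continuous_on {0..} (\<lambda>s. R s \<omega>)" and "0 < t"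
  shows "hitting_time R y \<omega> \<le> ereal t \<longleftrightarrow> (\<exists>n. \<exists>u\<in>{1 / real (Suc n)..t}. R u \<omega> = (y::real))"
proof
  assume "\<exists>n. \<exists>u\<in>{1 / real (Suc n)..t}. R u \<omega> = y"
  then obtain n u where u: "1 / real (Suc n) \<le> u" "u \<le> t" "R u \<omega> = y" by auto
  moreover have "0 < u" using u(1) by (rule less_le_trans[rotated]) simp
  ultimately show "hitting_time R y \<omega> \<le> ereal t"
    unfolding hitting_time_def by (intro Inf_lower2[of "ereal u"]) auto
next
  assume le: "hitting_time R y \<omega> \<le> ereal t"
  have "\<exists>u\<in>{0<..t}. R u \<omega> = y"
  proof (rule ccontr)
    assume no: "\<not> (\<exists>u\<in>{0<..t}. R u \<omega> = y)"
    have "isCont (\<lambda>s. R s \<omega>) t"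
      using \<open>0 < t\<close> by (intro continuous_on_interior[OF cont]) simp
    moreover have "R t \<omega> \<noteq> y" using no \<open>0 < t\<close> by auto
    \<comment> \<open>A path without a visit up to time \<open>t\<close> avoids \<open>y\<close> a little longer.\<close>
    ultimately obtain e where e: "e > 0" "\<And>u. dist t u < e \<Longrightarrow> R u \<omega> \<noteq> y"
      using continuous_at_avoid[of t "\<lambda>s. R s \<omega>" y] by auto
    have "t + e \<le> u" if "0 < u" "R u \<omega> = y" for u
    proof (rule ccontr)
      assume "\<not> t + e \<le> u"
      moreover have "t < u" using no that by force
      ultimately show False using e(2)[of u] that by (auto simp: dist_real_def)
    qed
    then have "ereal (t + e) \<le> hitting_time R y \<omega>"
      unfolding hitting_time_def by (intro Inf_greatest) auto
    from order_trans[OF this le] show False using e(1) by simp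
  qed
  then obtain u where u: "0 < u" "u \<le> t" "R u \<omega> = y" by auto
  obtain n where "inverse (real (Suc n)) < u" using reals_Archimedean u(1) by blast
  then show "\<exists>n. \<exists>u\<in>{1 / real (Suc n)..t}. R u \<omega> = y"
    using u by (intro exI[of _ n] bexI[of _ u]) (auto simp: field_simps)
qed

section \<open>Brownian increments\<close>

context prob_space
begin

lemma brownian_increment_indep:
  assumes bm: "standard_brownian_motion F B" and su: "0 \<le> s" "s < u"
    and E: "E \<in> sets (F s)" and S: "S \<in> sets borel"
  shows "prob (E \<inter> {\<omega>\<in>space M. B u \<omega> - B s \<omega> \<in> S}) = prob E * prob {\<omega>\<in>space M. B u \<omega> - B s \<omega> \<in> S}"
proof (rule indep_setD)
  show "indep_set (sets (F s)) (sets (vimage_algebra (space M) (\<lambda>\<omega>. B u \<omega> - B s \<omega>) borel))"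
    using bm su by (simp add: standard_brownian_motion_def)
  have "(\<lambda>\<omega>. B u \<omega> - B s \<omega>) -` S \<inter> space M \<in> sets (vimage_algebra (space M) (\<lambda>\<omega>. B u \<omega> - B s \<omega>) borel)"
    using S by (rule in_vimage_algebra)
  also have "(\<lambda>\<omega>. B u \<omega> - B s \<omega>) -` S \<inter> space M = {\<omega>\<in>space M. B u \<omega> - B s \<omega> \<in> S}" by auto
  finally show "{\<omega>\<in>space M. B u \<omega> - B s \<omega> \<in> S} \<in> sets (vimage_algebra (space M) (\<lambda>\<omega>. B u \<omega> - B s \<omega>) borel)" .
qed (fact E)

lemma brownian_measurable:
  assumes bm: "standard_brownian_motion F B"
  shows "0 \<le> s \<Longrightarrow> X \<in> borel_measurable (F s) \<Longrightarrow> X \<in> borel_measurable M"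
    and "0 \<le> s \<Longrightarrow> s \<le> u \<Longrightarrow> X \<in> borel_measurable (F s) \<Longrightarrow> X \<in> borel_measurable (F u)"
    and "0 \<le> s \<Longrightarrow> B s \<in> borel_measurable (F s)"
    and "space (F s) = space M"
    and "0 \<le> s \<Longrightarrow> s \<le> u \<Longrightarrow> sets (F s) \<subseteq> sets (F u)"
    and "0 \<le> s \<Longrightarrow> sets (F s) \<subseteq> sets M"
proof -
  interpret filtration "space M" F using bm by (simp add: standard_brownian_motion_def)
  have sub: "subalgebra M (F s)" if "0 \<le> s" for s using bm that by (simp add: standard_brownian_motion_def)
  show "0 \<le> s \<Longrightarrow> X \<in> borel_measurable (F s) \<Longrightarrow> X \<in> borel_measurable M"
    using sub measurable_from_subalg by blast
  show "0 \<le> s \<Longrightarrow> s \<le> u \<Longrightarrow> X \<in> borel_measurable (F s) \<Longrightarrow> X \<in> borel_measurable (F u)"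
    by (rule measurable_from_subalg[of "F u" "F s"]) (auto simp: subalgebra_def space_F sets_F_mono subsetD[OF sets_F_mono])
  show "0 \<le> s \<Longrightarrow> B s \<in> borel_measurable (F s)" using bm by (simp add: standard_brownian_motion_def)
  show "space (F s) = space M" by (rule space_F)
  show "0 \<le> s \<Longrightarrow> s \<le> u \<Longrightarrow> sets (F s) \<subseteq> sets (F u)" by (rule sets_F_mono)
  show "0 \<le> s \<Longrightarrow> sets (F s) \<subseteq> sets M" using sub by (simp add: subalgebra_def)
qed

text \<open>
  An increment after time \<open>s\<close> is independent of \<open>Y\<close>, so the expectations factorize into those of \<open>Y\<close>
  and the first two normal moments.
\<close>
lemma brownian_increment_moments:
  assumes bm: "standard_brownian_motion F B" and su: "0 \<le> s" "s \<le> u"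
    and Y: "Y \<in> borel_measurable (F s)" "integrable M Y"
  shows "integrable M (\<lambda>\<omega>. Y \<omega> * (B u \<omega> - B s \<omega>))"
    and "expectation (\<lambda>\<omega>. Y \<omega> * (B u \<omega> - B s \<omega>)) = 0"
    and "integrable M (\<lambda>\<omega>. Y \<omega> * (B u \<omega> - B s \<omega>)\<^sup>2)"
    and "expectation (\<lambda>\<omega>. Y \<omega> * (B u \<omega> - B s \<omega>)\<^sup>2) = (u - s) * expectation Y"
proof -
  let ?D = "\<lambda>\<omega>. B u \<omega> - B s \<omega>"
  have "integrable M (\<lambda>\<omega>. Y \<omega> * ?D \<omega>) \<and> expectation (\<lambda>\<omega>. Y \<omega> * ?D \<omega>) = 0 \<and>
        integrable M (\<lambda>\<omega>. Y \<omega> * (?D \<omega>)\<^sup>2) \<and>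
        expectation (\<lambda>\<omega>. Y \<omega> * (?D \<omega>)\<^sup>2) = (u - s) * expectation Y"
  proof (cases "s = u")
    case False
    then have su': "s < u" using su by simp
    have D: "distributed M lborel ?D (normal_density 0 (sqrt (u - s)))"
      and ind: "indep_set (sets (F s)) (sets (vimage_algebra (space M) ?D borel))"
      using bm su su' by (auto simp: standard_brownian_motion_def)
    have pos: "0 < sqrt (u - s)" using su' by simp
    have [measurable]: "?D \<in> borel_measurable M"
      using distributed_measurable[OF D] by simp
    have YM: "Y \<in> borel_measurable M" using brownian_measurable(1)[OF bm su(1) Y(1)] .
    have indep: "indep_var borel Y borel ?D"
      unfolding indep_var_eq
    proof (intro conjI)
      show "indep_set (sigma_sets (space M) {Y -` A \<inter> space M |A. A \<in> sets borel})
          (sigma_sets (space M) {?D -` A \<inter> space M |A. A \<in> sets borel})"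
        using ind unfolding indep_set_def
      proof (rule indep_sets_mono_sets)
        fix b
        have "sigma_sets (space M) {Y -` A \<inter> space M |A. A \<in> sets borel} \<subseteq> sets (F s)"
          using Y(1) brownian_measurable(4)[OF bm, of s]
          by (intro sets.sigma_sets_subset'[of _ "F s", simplified])
             (auto simp: measurable_sets sets.top[of "F s", simplified] dest: measurable_sets)
        then show "case_bool (sigma_sets (space M) {Y -` A \<inter> space M |A. A \<in> sets borel})
          (sigma_sets (space M) {?D -` A \<inter> space M |A. A \<in> sets borel}) b \<subseteq>
          case_bool (sets (F s)) (sets (vimage_algebra (space M) ?D borel)) b"
          by (auto simp: sets_vimage_algebra split: bool.split)
      qed
    qed (use YM in auto)
    have int1: "integrable M ?D"
      using integrable_normal_moment[OF pos, of 0 1] distributed_integrable[OF D, of "\<lambda>x. x"] by simp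
    have E1: "expectation ?D = 0" by (rule normal_distributed_expectation[OF pos D])
    have int2: "integrable M (\<lambda>\<omega>. (?D \<omega>)\<^sup>2)"
      using integrable_normal_moment[OF pos, of 0 2] distributed_integrable[OF D, of "\<lambda>x. x\<^sup>2"] by simp
    have E2: "expectation (\<lambda>\<omega>. (?D \<omega>)\<^sup>2) = u - s"
      using normal_distributed_variance[OF pos D] su' unfolding E1 by simp
    have "indep_var borel (id \<circ> Y) borel ((\<lambda>x. x\<^sup>2) \<circ> ?D)"
      by (rule indep_var_compose[OF indep]) auto
    then have indep2: "indep_var borel Y borel (\<lambda>\<omega>. (?D \<omega>)\<^sup>2)" by (simp add: comp_def)
    show ?thesis
      using indep_var_integrable[OF indep Y(2) int1] indep_var_lebesgue_integral[OF indep Y(2) int1]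
        indep_var_integrable[OF indep2 Y(2) int2] indep_var_lebesgue_integral[OF indep2 Y(2) int2] E1 E2
      by simp
  qed simp
  then show "integrable M (\<lambda>\<omega>. Y \<omega> * (B u \<omega> - B s \<omega>))"
    and "expectation (\<lambda>\<omega>. Y \<omega> * (B u \<omega> - B s \<omega>)) = 0"
    and "integrable M (\<lambda>\<omega>. Y \<omega> * (B u \<omega> - B s \<omega>)\<^sup>2)"
    and "expectation (\<lambda>\<omega>. Y \<omega> * (B u \<omega> - B s \<omega>)\<^sup>2) = (u - s) * expectation Y"
    by auto
qed

section \<open>Integrals of simple processes\<close>

lemma simple_process_partition:
  assumes "simple_process F t n p \<xi>" "i \<le> j" "j \<le> n"
  shows "p i \<le> p j"
  using assms(2,3)
proof (induction j rule: dec_induct)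
  case (step k)
  then have "p k \<le> p (Suc k)" using assms(1) by (simp add: simple_process_def)
  then show ?case using step by simp
qed simp

lemma simple_process_0_le:
  assumes "simple_process F t n p \<xi>" "i \<le> n"
  shows "0 \<le> p i"
  using simple_process_partition[OF assms(1), of 0 i] assms by (simp add: simple_process_def)

text \<open>
  The pathwise integral of the square of the simple process over \<open>{0..t}\<close>.
\<close>
definition simple_energy :: "nat \<Rightarrow> (nat \<Rightarrow> real) \<Rightarrow> (nat \<Rightarrow> 'a \<Rightarrow> real) \<Rightarrow> 'a \<Rightarrow> real" where
  "simple_energy n p \<xi> \<omega> = (\<Sum>i<n. (\<xi> i \<omega>)\<^sup>2 * (p (Suc i) - p i))"

lemma simple_integral_measurable:
  assumes bm: "standard_brownian_motion F B" and sp: "simple_process F t n p \<xi>"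
  shows "simple_integral B n p \<xi> \<in> borel_measurable (F t)"
    and "simple_energy n p \<xi> \<in> borel_measurable (F t)"
proof -
  have t: "p n = t" using sp by (simp add: simple_process_def)
  have xi: "\<xi> i \<in> borel_measurable (F t)" if "i < n" for i
    using brownian_measurable(2)[OF bm, of "p i" t "\<xi> i"] sp that t
      simple_process_0_le[OF sp, of i] simple_process_partition[OF sp, of i n]
    by (simp add: simple_process_def)
  have Bp: "B (p i) \<in> borel_measurable (F t)" if "i \<le> n" for i
    using brownian_measurable(2)[OF bm, of "p i" t "B (p i)"] that t brownian_measurable(3)[OF bm]
      simple_process_0_le[OF sp, of i] simple_process_partition[OF sp, of i n]
    by simp
  show "simple_integral B n p \<xi> \<in> borel_measurable (F t)"
    unfolding simple_integral_def[abs_def]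
    by (intro borel_measurable_sum borel_measurable_times borel_measurable_diff xi Bp) auto
  show "simple_energy n p \<xi> \<in> borel_measurable (F t)"
    unfolding simple_energy_def[abs_def]
    by (intro borel_measurable_sum borel_measurable_times borel_measurable_power borel_measurable_diff xi) auto
qed

text \<open>
  Adding an interval changes \<open>I\<^sup>2\<close> by \<open>2 I \<xi> \<Delta>B + \<xi>\<^sup>2 (\<Delta>B)\<^sup>2\<close>. As \<open>I \<xi>\<close> and \<open>\<xi>\<^sup>2\<close> are known at the beginning of the
  interval, the first term has expectation \<open>0\<close> and the second one that of the added energy.
\<close>
lemma simple_integral_isometry:
  assumes bm: "standard_brownian_motion F B" and sp: "simple_process F t n p \<xi>"
  shows "integrable M (\<lambda>\<omega>. (simple_integral B n p \<xi> \<omega>)\<^sup>2) \<and> integrable M (simple_energy n p \<xi>) \<and>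
         expectation (\<lambda>\<omega>. (simple_integral B n p \<xi> \<omega>)\<^sup>2) = expectation (simple_energy n p \<xi>)"
  using sp
proof (induction n arbitrary: t)
  case 0
  then show ?case by (simp add: simple_integral_def simple_energy_def[abs_def])
next
  case (Suc n)
  have sp: "simple_process F (p n) n p \<xi>" using Suc.prems by (simp add: simple_process_def)
  let ?I = "simple_integral B n p \<xi>" and ?D = "\<lambda>\<omega>. B (p (Suc n)) \<omega> - B (p n) \<omega>"
  note IH = Suc.IH[OF sp]
  have p: "0 \<le> p n" "p n \<le> p (Suc n)"
    using simple_process_0_le[OF Suc.prems, of n] Suc.prems by (auto simp: simple_process_def)
  have I: "?I \<in> borel_measurable (F (p n))" by (rule simple_integral_measurable[OF bm sp])
  have x: "\<xi> n \<in> borel_measurable (F (p n))" using Suc.prems by (simp add: simple_process_def)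
  note toM = brownian_measurable(1)[OF bm p(1)]
  obtain K where K: "\<And>\<omega>. \<omega> \<in> space M \<Longrightarrow> \<bar>\<xi> n \<omega>\<bar> \<le> K"
    using Suc.prems unfolding simple_process_def by blast
  have IM: "?I \<in> borel_measurable M" and xM: "\<xi> n \<in> borel_measurable M"
    using toM[OF I] toM[OF x] .
  have "integrable M ?I"
    using IM IH by (blast intro: square_integrable_imp_integrable)
  then have "integrable M (\<lambda>\<omega>. K * ?I \<omega>)" by simp
  moreover have "(\<lambda>\<omega>. \<xi> n \<omega> * ?I \<omega>) \<in> borel_measurable M"
    using xM IM by (rule borel_measurable_times)
  moreover have "AE \<omega> in M. norm (\<xi> n \<omega> * ?I \<omega>) \<le> norm (K * ?I \<omega>)"
  proof (rule AE_I2)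
    fix \<omega> assume "\<omega> \<in> space M"
    from K[OF this] have "\<bar>\<xi> n \<omega>\<bar> \<le> \<bar>K\<bar>" by linarith
    from mult_right_mono[OF this abs_ge_zero]
    show "norm (\<xi> n \<omega> * ?I \<omega>) \<le> norm (K * ?I \<omega>)" by (simp add: abs_mult)
  qed
  ultimately have "integrable M (\<lambda>\<omega>. \<xi> n \<omega> * ?I \<omega>)"
    by (rule Bochner_Integration.integrable_bound)
  then have YI: "integrable M (\<lambda>\<omega>. 2 * (\<xi> n \<omega> * ?I \<omega>))" by simp
  have "AE \<omega> in M. norm ((\<xi> n \<omega>)\<^sup>2) \<le> K\<^sup>2"
  proof (rule AE_I2)
    fix \<omega> assume "\<omega> \<in> space M"
    from power_mono[OF K[OF this], of 2] show "norm ((\<xi> n \<omega>)\<^sup>2) \<le> K\<^sup>2" by simp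
  qed
  then have "integrable M (\<lambda>\<omega>. (\<xi> n \<omega>)\<^sup>2)"
    using xM by (intro integrable_const_bound[where B = "K\<^sup>2"] borel_measurable_power)
  note sq = brownian_increment_moments[OF bm p borel_measurable_power[OF x] this]
  note cross = brownian_increment_moments[OF bm p borel_measurable_times[OF borel_measurable_const borel_measurable_times[OF x I]] YI]
  have I_Suc: "(simple_integral B (Suc n) p \<xi> \<omega>)\<^sup>2 =
      (?I \<omega>)\<^sup>2 + 2 * (\<xi> n \<omega> * ?I \<omega>) * ?D \<omega> + (\<xi> n \<omega>)\<^sup>2 * (?D \<omega>)\<^sup>2" for \<omega>
    by (simp add: simple_integral_def power2_eq_square algebra_simps)
  have E_Suc: "simple_energy (Suc n) p \<xi> = (\<lambda>\<omega>. simple_energy n p \<xi> \<omega> + (\<xi> n \<omega>)\<^sup>2 * (p (Suc n) - p n))"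
    by (simp add: simple_energy_def fun_eq_iff)
  have "integrable M (\<lambda>\<omega>. (\<xi> n \<omega>)\<^sup>2)" by fact
  then show ?case
    unfolding I_Suc E_Suc using IH sq cross by (simp add: mult.commute)
qed

text \<open>
  Switch the integrand off on the first interval whose energy would carry the total above \<open>b\<close>, and
  afterwards. This decision is known at the beginning of the interval, so the result \<open>\<zeta>\<close> is again a
  simple process; its energy is at most \<open>b\<close> everywhere, so the isometry and Chebyshev's inequality
  give \<open>b / a\<^sup>2\<close>. Where the total energy is at most \<open>b\<close>, the two integrals agree.
\<close>
lemma simple_integral_tail:
  assumes bm: "standard_brownian_motion F B" and sp: "simple_process F t n p \<xi>" and "0 < a" "0 \<le> b"
  shows "prob {\<omega>\<in>space M. a < \<bar>simple_integral B n p \<xi> \<omega>\<bar>}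
          \<le> b / a\<^sup>2 + prob {\<omega>\<in>space M. b < simple_energy n p \<xi> \<omega>}"
proof -
  define \<zeta> where "\<zeta> i \<omega> = (if simple_energy (Suc i) p \<xi> \<omega> \<le> b then \<xi> i \<omega> else 0)" for i \<omega>
  have dp: "0 \<le> p (Suc i) - p i" if "i < n" for i using sp that by (simp add: simple_process_def)
  have t: "0 \<le> t" using simple_process_0_le[OF sp, of n] sp by (simp add: simple_process_def)
  have sp': "simple_process F t n p \<zeta>"
    unfolding simple_process_def
  proof (intro conjI allI impI)
    fix i assume i: "i < n"
    have "simple_process F (p i) i p \<xi>" using sp i by (simp add: simple_process_def)
    from simple_integral_measurable(2)[OF bm this]
    have [measurable]: "simple_energy i p \<xi> \<in> borel_measurable (F (p i))" .
    have [measurable]: "\<xi> i \<in> borel_measurable (F (p i))" using sp i by (simp add: simple_process_def)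
    have eq: "simple_energy (Suc i) p \<xi> = (\<lambda>\<omega>. simple_energy i p \<xi> \<omega> + (\<xi> i \<omega>)\<^sup>2 * (p (Suc i) - p i))"
      by (simp add: simple_energy_def fun_eq_iff)
    show "\<zeta> i \<in> borel_measurable (F (p i))" unfolding \<zeta>_def[abs_def] eq by measurable
    obtain K where "\<forall>\<omega>\<in>space M. \<bar>\<xi> i \<omega>\<bar> \<le> K" using sp i by (auto simp: simple_process_def)
    then show "\<exists>K. \<forall>\<omega>\<in>space M. \<bar>\<zeta> i \<omega>\<bar> \<le> K"
      by (intro exI[of _ "max K 0"]) (auto simp: \<zeta>_def)
  qed (use sp in \<open>auto simp: simple_process_def\<close>)
  have energy: "simple_energy m p \<zeta> \<omega> \<le> min b (simple_energy m p \<xi> \<omega>)" if "m \<le> n" for m \<omega>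
    using that
  proof (induction m)
    case 0
    then show ?case using \<open>0 \<le> b\<close> by (simp add: simple_energy_def)
  next
    case (Suc m)
    have "0 \<le> (\<xi> m \<omega>)\<^sup>2 * (p (Suc m) - p m)" using dp[of m] Suc.prems by simp
    then show ?case using Suc by (auto simp: simple_energy_def \<zeta>_def)
  qed
  have mono: "simple_energy m p \<xi> \<omega> \<le> simple_energy n p \<xi> \<omega>" if "m \<le> n" for m \<omega>
    unfolding simple_energy_def using that dp by (intro sum_mono2) auto
  have eq: "simple_integral B n p \<zeta> \<omega> = simple_integral B n p \<xi> \<omega>" if "simple_energy n p \<xi> \<omega> \<le> b" for \<omega>
    unfolding simple_integral_def
  proof (rule sum.cong)
    fix i assume "i \<in> {..<n}"
    then have "simple_energy (Suc i) p \<xi> \<omega> \<le> b" using mono[of "Suc i" \<omega>] that by auto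
    then show "\<zeta> i \<omega> * (B (p (Suc i)) \<omega> - B (p i) \<omega>) = \<xi> i \<omega> * (B (p (Suc i)) \<omega> - B (p i) \<omega>)"
      by (simp add: \<zeta>_def)
  qed simp
  have [measurable]: "simple_integral B n p \<zeta> \<in> borel_measurable M" "simple_integral B n p \<xi> \<in> borel_measurable M"
    "simple_energy n p \<xi> \<in> borel_measurable M"
    using brownian_measurable(1)[OF bm t] simple_integral_measurable[OF bm] sp sp' by blast+
  note iso = simple_integral_isometry[OF bm sp']
  have "expectation (simple_energy n p \<zeta>) \<le> expectation (\<lambda>_. b)"
    using iso energy[of n] by (intro integral_mono) auto
  then have second: "expectation (\<lambda>\<omega>. (simple_integral B n p \<zeta> \<omega>)\<^sup>2) \<le> b"
    using iso by (simp add: prob_space)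
  have "prob {\<omega>\<in>space M. a < \<bar>simple_integral B n p \<xi> \<omega>\<bar>}
      \<le> prob ({\<omega>\<in>space M. a \<le> \<bar>simple_integral B n p \<zeta> \<omega>\<bar>} \<union> {\<omega>\<in>space M. b < simple_energy n p \<xi> \<omega>})"
    using eq by (intro finite_measure_mono) force+
  also have "\<dots> \<le> prob {\<omega>\<in>space M. a \<le> \<bar>simple_integral B n p \<zeta> \<omega>\<bar>} + prob {\<omega>\<in>space M. b < simple_energy n p \<xi> \<omega>}"
    by (intro measure_Un_le) auto
  also have "prob {\<omega>\<in>space M. a \<le> \<bar>simple_integral B n p \<zeta> \<omega>\<bar>} \<le> b / a\<^sup>2"
    using second_moment_method[of "simple_integral B n p \<zeta>" a] iso \<open>0 < a\<close>
      divide_right_mono[OF second, of "a\<^sup>2"]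
    by auto
  finally show ?thesis by simp
qed

section \<open>Ito integrals of nearly constant integrands\<close>

lemma sum_over_partition:
  fixes a :: "nat \<Rightarrow> real"
  assumes sp: "simple_process F t n p \<xi>" and i: "i < n" "s \<in> {p i<..p (Suc i)}"
  shows "(\<Sum>j<n. a j * indicator {p j<..p (Suc j)} s) = a i"
proof -
  have "s \<notin> {p j<..p (Suc j)}" if "j < n" "j \<noteq> i" for j
    using simple_process_partition[OF sp, of "Suc j" i] simple_process_partition[OF sp, of "Suc i" j] i that
    by (cases "j < i") auto
  then have "(\<Sum>j<n. a j * indicator {p j<..p (Suc j)} s) = (\<Sum>j<n. if j = i then a i else 0)"
    using i(2) by (intro sum.cong) (auto simp: indicator_def simp del: greaterThanAtMost_iff)
  then show ?thesis using i(1) by simp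
qed

lemma simple_energy_eq_nn_integral:
  assumes sp: "simple_process F t n p \<xi>"
  shows "ennreal (simple_energy n p \<xi> \<omega>) =
    (\<integral>\<^sup>+s. ennreal (\<Sum>i<n. (\<xi> i \<omega>)\<^sup>2 * indicator {p i<..p (Suc i)} s) \<partial>lborel)"
proof -
  have "(\<integral>\<^sup>+s. ennreal (\<Sum>i<n. (\<xi> i \<omega>)\<^sup>2 * indicator {p i<..p (Suc i)} s) \<partial>lborel) =
        (\<integral>\<^sup>+s. (\<Sum>i<n. ennreal ((\<xi> i \<omega>)\<^sup>2) * indicator {p i<..p (Suc i)} s) \<partial>lborel)"
  proof (rule nn_integral_cong)
    fix s :: real
    have "ennreal (\<Sum>i<n. (\<xi> i \<omega>)\<^sup>2 * indicator {p i<..p (Suc i)} s) =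
          (\<Sum>i<n. ennreal ((\<xi> i \<omega>)\<^sup>2 * indicator {p i<..p (Suc i)} s))"
      by (rule sum_ennreal[symmetric]) simp
    also have "\<dots> = (\<Sum>i<n. ennreal ((\<xi> i \<omega>)\<^sup>2) * indicator {p i<..p (Suc i)} s)"
      by (intro sum.cong refl) (simp split: split_indicator)
    finally show "ennreal (\<Sum>i<n. (\<xi> i \<omega>)\<^sup>2 * indicator {p i<..p (Suc i)} s) =
          (\<Sum>i<n. ennreal ((\<xi> i \<omega>)\<^sup>2) * indicator {p i<..p (Suc i)} s)" .
  qed
  also have "\<dots> = (\<Sum>i<n. ennreal ((\<xi> i \<omega>)\<^sup>2) * emeasure lborel {p i<..p (Suc i)})"
    by (subst nn_integral_sum) (auto simp: nn_integral_cmult_indicator)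
  also have "\<dots> = (\<Sum>i<n. ennreal ((\<xi> i \<omega>)\<^sup>2 * (p (Suc i) - p i)))"
    using sp by (intro sum.cong) (auto simp: simple_process_def ennreal_mult)
  also have "\<dots> = ennreal (simple_energy n p \<xi> \<omega>)"
    unfolding simple_energy_def
    using sp by (intro sum_ennreal) (auto simp: simple_process_def)
  finally show ?thesis ..
qed

lemma simple_process_diff_const:
  assumes sp: "simple_process F t n p \<xi>"
  shows "simple_process F t n p (\<lambda>i \<omega>. \<xi> i \<omega> - c)"
    and "simple_integral B n p (\<lambda>i \<omega>. \<xi> i \<omega> - c) \<omega> = simple_integral B n p \<xi> \<omega> - c * (B t \<omega> - B 0 \<omega>)"
proof -
  show "simple_process F t n p (\<lambda>i \<omega>. \<xi> i \<omega> - c)"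
    unfolding simple_process_def
  proof (intro conjI allI impI)
    fix i assume i: "i < n"
    then obtain K where "\<forall>\<omega>\<in>space M. \<bar>\<xi> i \<omega>\<bar> \<le> K" using sp unfolding simple_process_def by blast
    then show "\<exists>K. \<forall>\<omega>\<in>space M. \<bar>\<xi> i \<omega> - c\<bar> \<le> K"
      by (intro exI[of _ "K + \<bar>c\<bar>"]) (auto intro: order_trans[OF abs_triangle_ineq4])
  qed (use sp in \<open>auto simp: simple_process_def\<close>)
  have "(\<Sum>i<n. B (p (Suc i)) \<omega> - B (p i) \<omega>) = B (p n) \<omega> - B (p 0) \<omega>"
    by (rule sum_lessThan_telescope)
  then show "simple_integral B n p (\<lambda>i \<omega>. \<xi> i \<omega> - c) \<omega> = simple_integral B n p \<xi> \<omega> - c * (B t \<omega> - B 0 \<omega>)"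
    using sp by (simp add: simple_integral_def simple_process_def left_diff_distrib sum_subtractf
        sum_distrib_left[symmetric])
qed

text \<open>
  Freezing the process outside \<open>{0..t}\<close> turns joint measurability on the restricted product space into
  measurability on the full one, where Tonelli's theorem applies.
\<close>
lemma jointly_measurable_clamped:
  assumes H: "(\<lambda>(s, \<omega>). H s \<omega>) \<in> borel_measurable (restrict_space borel {0..t} \<Otimes>\<^sub>M F t)"
    and bm: "standard_brownian_motion F B" and "0 \<le> (t::real)"
  shows "(\<lambda>(s, \<omega>). H (max 0 (min t s)) \<omega> :: real) \<in> borel_measurable (lborel \<Otimes>\<^sub>M M)"
proof -
  have "subalgebra M (F t)" using bm \<open>0 \<le> t\<close> by (simp add: standard_brownian_motion_def)
  then have [measurable]: "(\<lambda>\<omega>. \<omega>) \<in> measurable M (F t)"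
    by (auto simp: subalgebra_def measurable_def)
  have [measurable]: "(\<lambda>s. max 0 (min t s)) \<in> measurable lborel (restrict_space borel {0..t})"
    using \<open>0 \<le> t\<close> by (intro measurable_restrict_space2) auto
  have "(\<lambda>x. (max 0 (min t (fst x)), snd x)) \<in> measurable (lborel \<Otimes>\<^sub>M M) (restrict_space borel {0..t} \<Otimes>\<^sub>M F t)"
    by measurable
  from measurable_compose[OF this H] show ?thesis
    by (simp add: case_prod_beta' )
qed

text \<open>
  Subtracting the constant \<open>c\<close> from the approximating simple processes subtracts \<open>c B\<^sub>t\<close> from their
  integrals. On \<open>D\<close>, once the approximation error is at most \<open>\<eta> t\<close>, which fails with a probability
  tending to \<open>0\<close>, the energy of the difference is at most \<open>4 \<eta> t\<close>, by \<open>(x - c)\<^sup>2 \<le> 2 (x - h)\<^sup>2 + 2 (h - c)\<^sup>2\<close>, so the tail bound for simple integrals applies. One \<open>a\<close> of the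
  \<open>2 a\<close> pays for passing from the simple integrals to their limit \<open>J\<close>.
\<close>
lemma ito_integral_near_constant:
  assumes bm: "standard_brownian_motion F B" and ito: "has_ito_integral F B H t J"
    and pos: "0 < t" "0 < \<eta>" "0 < a" and D: "D \<in> events"
    and near: "\<And>\<omega> s. \<omega> \<in> D \<Longrightarrow> s \<in> {0..t} \<Longrightarrow> (H s \<omega> - c)\<^sup>2 \<le> \<eta>"
  shows "prob {\<omega>\<in>space M. 2 * a < \<bar>J \<omega> - c * B t \<omega>\<bar>} \<le> 4 * \<eta> * t / a\<^sup>2 + prob (space M - D)"
proof -
  obtain n p \<xi> where sp: "\<And>k. simple_process F t (n k) (p k) (\<xi> k)"
    and err: "\<And>e. e > 0 \<Longrightarrow> (\<lambda>k. prob {\<omega>\<in>space M. ennreal e <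
         (\<integral>\<^sup>+s\<in>{0..t}. ennreal ((simple_value (n k) (p k) (\<xi> k) s \<omega> - H s \<omega>)\<^sup>2) \<partial>lborel)}) \<longlonglongrightarrow> 0"
    and lim: "tendsto_in_prob (\<lambda>k. simple_integral B (n k) (p k) (\<xi> k)) J"
    using ito unfolding has_ito_integral_def by blast
  define Err where "Err k \<omega> =
    (\<integral>\<^sup>+s\<in>{0..t}. ennreal ((simple_value (n k) (p k) (\<xi> k) s \<omega> - H s \<omega>)\<^sup>2) \<partial>lborel)" for k \<omega>
  define G where "G = (\<lambda>(s, \<omega>). H (max 0 (min t s)) \<omega>)"
  have [measurable]: "G \<in> borel_measurable (lborel \<Otimes>\<^sub>M M)"
    unfolding G_def using ito pos by (intro jointly_measurable_clamped[OF _ bm]) (simp_all add: has_ito_integral_def)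
  have HG: "H s \<omega> = G (s, \<omega>)" if "s \<in> {0..t}" for s \<omega>
    using that by (simp add: G_def)
  have xi_M: "\<xi> k i \<in> borel_measurable M" if "i < n k" for k i
    using brownian_measurable(1)[OF bm, of "p k i" "\<xi> k i"] simple_process_0_le[OF sp[of k], of i] sp[of k] that
    by (simp add: simple_process_def)
  have sv[measurable]: "(\<lambda>x. simple_value (n k) (p k) (\<xi> k) (fst x) (snd x)) \<in> borel_measurable (lborel \<Otimes>\<^sub>M M)" for k
    unfolding simple_value_def
    by (intro borel_measurable_sum borel_measurable_times measurable_compose[OF measurable_snd xi_M]) auto
  have Err_eq: "Err k \<omega> = (\<integral>\<^sup>+s. ennreal ((simple_value (n k) (p k) (\<xi> k) s \<omega> - G (s, \<omega>))\<^sup>2) * indicator {0..t} s \<partial>lborel)" for k \<omega>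
    unfolding Err_def by (intro nn_integral_cong) (auto simp: HG indicator_def)
  have Err_int: "(\<lambda>x. ennreal ((simple_value (n k) (p k) (\<xi> k) (fst x) (snd x) - G x)\<^sup>2) * indicator {0..t} (fst x))
      \<in> borel_measurable (lborel \<Otimes>\<^sub>M M)" for k
    by measurable
  \<comment> \<open>Without measurability of these errors their convergence to \<open>0\<close> in probability would say nothing,
    as a non-measurable set has probability \<open>0\<close> by convention.\<close>
  have Err_M[measurable]: "Err k \<in> borel_measurable M" for k
  proof -
    have "(\<lambda>(\<omega>, s). ennreal ((simple_value (n k) (p k) (\<xi> k) s \<omega> - G (s, \<omega>))\<^sup>2) * indicator {0..t} s)
      \<in> borel_measurable (M \<Otimes>\<^sub>M lborel)"
      using measurable_compose[OF measurable_pair_swap' Err_int[of k]] by (simp add: case_prod_beta')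
    from lborel.borel_measurable_nn_integral[OF this] show ?thesis
      unfolding Err_eq[abs_def] .
  qed
  have energy: "simple_energy (n k) (p k) (\<lambda>i \<omega>. \<xi> k i \<omega> - c) \<omega> \<le> 4 * \<eta> * t"
    if "\<omega> \<in> D" and small: "Err k \<omega> \<le> ennreal (\<eta> * t)" for k \<omega>
  proof -
    have \<omega>: "\<omega> \<in> space M" using that(1) D sets.sets_into_space by blast
    have "ennreal (simple_energy (n k) (p k) (\<lambda>i \<omega>. \<xi> k i \<omega> - c) \<omega>) =
      (\<integral>\<^sup>+s. ennreal (\<Sum>i<n k. (\<xi> k i \<omega> - c)\<^sup>2 * indicator {p k i<..p k (Suc i)} s) \<partial>lborel)"
      by (rule simple_energy_eq_nn_integral[OF simple_process_diff_const(1)[OF sp]])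
    also have "\<dots> \<le> (\<integral>\<^sup>+s. ennreal 2 * (ennreal ((simple_value (n k) (p k) (\<xi> k) s \<omega> - G (s, \<omega>))\<^sup>2) * indicator {0..t} s)
        + ennreal (2 * \<eta>) * indicator {0..t} s \<partial>lborel)"
    proof (rule nn_integral_mono)
      fix s
      show "ennreal (\<Sum>i<n k. (\<xi> k i \<omega> - c)\<^sup>2 * indicator {p k i<..p k (Suc i)} s) \<le>
        ennreal 2 * (ennreal ((simple_value (n k) (p k) (\<xi> k) s \<omega> - G (s, \<omega>))\<^sup>2) * indicator {0..t} s)
        + ennreal (2 * \<eta>) * indicator {0..t} s"
      proof (cases "\<exists>i<n k. s \<in> {p k i<..p k (Suc i)}")
        case True
        then obtain i where i: "i < n k" "s \<in> {p k i<..p k (Suc i)}" by blast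
        have "s \<in> {0..t}"
          using i simple_process_partition[OF sp[of k], of "Suc i" "n k"] simple_process_0_le[OF sp[of k], of i] sp[of k]
          by (auto simp: simple_process_def)
        note sum_eq = sum_over_partition[OF sp[of k] i]
        have v: "simple_value (n k) (p k) (\<xi> k) s \<omega> = \<xi> k i \<omega>"
          unfolding simple_value_def by (rule sum_eq)
        have "(\<xi> k i \<omega> - c)\<^sup>2 \<le> 2 * (\<xi> k i \<omega> - G (s, \<omega>))\<^sup>2 + 2 * (G (s, \<omega>) - c)\<^sup>2"
          using zero_le_power2[of "(\<xi> k i \<omega> - G (s, \<omega>)) - (G (s, \<omega>) - c)"]
          by (simp add: power2_eq_square algebra_simps)
        also have "(G (s, \<omega>) - c)\<^sup>2 \<le> \<eta>"
          using near[OF \<open>\<omega> \<in> D\<close> \<open>s \<in> {0..t}\<close>] HG[OF \<open>s \<in> {0..t}\<close>] by simp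
        finally have "ennreal ((\<xi> k i \<omega> - c)\<^sup>2) \<le> ennreal (2 * (\<xi> k i \<omega> - G (s, \<omega>))\<^sup>2 + 2 * \<eta>)"
          by (intro ennreal_leI) simp
        also have "\<dots> = ennreal 2 * ennreal ((\<xi> k i \<omega> - G (s, \<omega>))\<^sup>2) + ennreal (2 * \<eta>)"
          using pos by (simp add: ennreal_plus ennreal_mult)
        finally show ?thesis
          using \<open>s \<in> {0..t}\<close> by (simp add: v sum_eq)
      next
        case False
        then have "(\<Sum>i<n k. (\<xi> k i \<omega> - c)\<^sup>2 * indicator {p k i<..p k (Suc i)} s) = 0"
          by (intro sum.neutral) (auto simp: indicator_def)
        then show ?thesis by simp
      qed
    qed
    also have "\<dots> = ennreal 2 * Err k \<omega> + ennreal (2 * \<eta>) * emeasure lborel {0..t}"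
    proof -
      have [measurable]: "(\<lambda>s. ennreal ((simple_value (n k) (p k) (\<xi> k) s \<omega> - G (s, \<omega>))\<^sup>2) * indicator {0..t} s)
          \<in> borel_measurable lborel"
        using measurable_compose[OF measurable_Pair2'[OF \<omega>] Err_int[of k]] by simp
      show ?thesis
        unfolding Err_eq by (subst nn_integral_add) (auto simp: nn_integral_cmult nn_integral_cmult_indicator)
    qed
    also have "\<dots> \<le> ennreal 2 * ennreal (\<eta> * t) + ennreal (2 * \<eta>) * ennreal t"
      using small pos by (intro add_mono mult_left_mono) auto
    also have "\<dots> = ennreal (2 * (\<eta> * t)) + ennreal (2 * \<eta> * t)"
      using pos by (subst (1 2) ennreal_mult) auto
    also have "\<dots> = ennreal (4 * \<eta> * t)"
      using pos by (subst ennreal_plus[symmetric]) (auto simp: algebra_simps)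
    finally show ?thesis using pos by (subst (asm) ennreal_le_iff) auto
  qed
  have J[measurable]: "J \<in> borel_measurable M"
    and I[measurable]: "\<And>k. simple_integral B (n k) (p k) (\<xi> k) \<in> borel_measurable M"
    using lim by (auto simp: tendsto_in_prob_def)
  have Bt[measurable]: "B t \<in> borel_measurable M"
    using brownian_measurable(1,3)[OF bm, of t] pos by simp
  have B0: "\<And>\<omega>. \<omega> \<in> space M \<Longrightarrow> B 0 \<omega> = 0" using bm by (simp add: standard_brownian_motion_def)
  let ?C = "\<lambda>k. {\<omega>\<in>space M. a < \<bar>simple_integral B (n k) (p k) (\<xi> k) \<omega> - J \<omega>\<bar>}"
  let ?E = "\<lambda>k. {\<omega>\<in>space M. ennreal (\<eta> * t) < Err k \<omega>}"
  have bound: "prob {\<omega>\<in>space M. 2 * a < \<bar>J \<omega> - c * B t \<omega>\<bar>}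
      \<le> prob (?C k) + (4 * \<eta> * t / a\<^sup>2 + (prob (?E k) + prob (space M - D)))" for k
  proof -
    let ?\<zeta> = "\<lambda>i \<omega>. \<xi> k i \<omega> - c"
    let ?I = "simple_integral B (n k) (p k) ?\<zeta>" and ?Q = "simple_energy (n k) (p k) ?\<zeta>"
    note sp' = simple_process_diff_const(1)[OF sp[of k], of c]
    have [measurable]: "?I \<in> borel_measurable M" "?Q \<in> borel_measurable M"
      using simple_integral_measurable[OF bm sp'] brownian_measurable(1)[OF bm, of t] pos by auto
    have I_eq: "?I \<omega> = simple_integral B (n k) (p k) (\<xi> k) \<omega> - c * B t \<omega>" if "\<omega> \<in> space M" for \<omega>
      using simple_process_diff_const(2)[OF sp[of k], of B c \<omega>] B0[OF that] by simp
    have "prob {\<omega>\<in>space M. 2 * a < \<bar>J \<omega> - c * B t \<omega>\<bar>} \<le> prob (?C k \<union> {\<omega>\<in>space M. a < \<bar>?I \<omega>\<bar>})"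
      by (intro finite_measure_mono) (auto simp: I_eq)
    also have "\<dots> \<le> prob (?C k) + prob {\<omega>\<in>space M. a < \<bar>?I \<omega>\<bar>}"
      by (intro measure_Un_le) auto
    also have "prob {\<omega>\<in>space M. a < \<bar>?I \<omega>\<bar>} \<le> 4 * \<eta> * t / a\<^sup>2 + prob {\<omega>\<in>space M. 4 * \<eta> * t < ?Q \<omega>}"
      using pos by (intro simple_integral_tail[OF bm sp']) auto
    also have "prob {\<omega>\<in>space M. 4 * \<eta> * t < ?Q \<omega>} \<le> prob (?E k \<union> (space M - D))"
      using energy[of _ k] D by (intro finite_measure_mono) (auto simp: not_le[symmetric])
    also have "\<dots> \<le> prob (?E k) + prob (space M - D)"
      using D by (intro measure_Un_le) auto
    finally show ?thesis by simp
  qed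
  have "(\<lambda>k. prob (?C k) + (4 * \<eta> * t / a\<^sup>2 + (prob (?E k) + prob (space M - D))))
      \<longlonglongrightarrow> 0 + (4 * \<eta> * t / a\<^sup>2 + (0 + prob (space M - D)))"
    using err[of "\<eta> * t"] lim pos unfolding Err_def tendsto_in_prob_def
    by (intro tendsto_add tendsto_const) auto
  from LIMSEQ_le_const[OF this] bound show ?thesis by auto
qed

end

section \<open>Immediate return to the starting point\<close>

definition normal_tail :: real where
  "normal_tail = measure (density lborel std_normal_density) {..<-3}"

lemma normal_tail_pos: "0 < normal_tail"
proof -
  interpret N: prob_space "density lborel std_normal_density"
    by (rule prob_space_normal_density) simp
  have "emeasure (density lborel std_normal_density) {..<-3} \<noteq> 0"
  proof
    assume "emeasure (density lborel std_normal_density) {..<-3} = 0"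
    then have "(\<integral>\<^sup>+x. ennreal (std_normal_density x) * indicator {..<-3} x \<partial>lborel) = 0"
      by (subst (asm) emeasure_density) auto
    then have "AE x in lborel. ennreal (std_normal_density x) * indicator {..<-3::real} x = 0"
      by (subst (asm) nn_integral_0_iff_AE) auto
    then have "AE x in lborel. x \<notin> {..<-3::real}"
      by eventually_elim (auto simp: indicator_def normal_density_def split: if_splits)
    then have "emeasure lborel {..<-3::real} = 0"
      by (subst (asm) AE_iff_measurable[where N = "{..<-3::real}"]) auto
    moreover have "emeasure lborel {-5..-4::real} \<le> emeasure lborel {..<-3::real}"
      by (intro emeasure_mono) auto
    ultimately show False by simp
  qed
  then show ?thesis
    unfolding normal_tail_def by (simp add: N.emeasure_eq_measure less_le)
qed

context prob_space
begin

text \<open>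
  The lower bound has to be uniform in \<open>r\<close> and \<open>s\<close>. The condition on \<open>r\<close> leaves a variance of at least
  \<open>s / 4\<close>, so \<open>\<sigma> (B\<^sub>s - B\<^sub>r) < -3 \<surd>(s - r)\<close> is sufficient, which is the event of \<open>normal_tail\<close> for a standard
  normal variable.
\<close>
lemma brownian_increment_tail:
  assumes bm: "standard_brownian_motion F B" and su: "0 \<le> r" "4 * r \<le> 3 * s" "0 < s"
    and \<sigma>: "\<sigma> \<in> {-1, 1::real}"
  shows "normal_tail \<le> prob {\<omega>\<in>space M. \<sigma> * (2 * (B s \<omega> - B r \<omega>)) < - 3 * sqrt s}"
proof -
  let ?v = "sqrt (s - r)"
  have v: "0 < ?v" using su by simp
  have half: "sqrt s \<le> 2 * ?v"
  proof -
    have "sqrt s \<le> sqrt (4 * (s - r))" using su by (intro real_sqrt_le_mono) simp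
    also have "\<dots> = sqrt 4 * ?v" by (rule real_sqrt_mult)
    finally show ?thesis by simp
  qed
  have "distributed M lborel (\<lambda>\<omega>. B s \<omega> - B r \<omega>) (normal_density 0 ?v)"
    using bm su by (simp add: standard_brownian_motion_def)
  from normal_density_affine[OF this v, of "\<sigma> / ?v" 0]
  have D: "distributed M lborel (\<lambda>\<omega>. \<sigma> / ?v * (B s \<omega> - B r \<omega>)) std_normal_density"
    using v \<sigma> by auto
  have BM: "B s \<in> borel_measurable M" "B r \<in> borel_measurable M"
    using brownian_measurable(1,3)[OF bm, of s] brownian_measurable(1,3)[OF bm, of r] su by auto
  have "normal_tail = measure (distr M lborel (\<lambda>\<omega>. \<sigma> / ?v * (B s \<omega> - B r \<omega>))) {..<-3}"
    unfolding normal_tail_def using distributed_distr_eq_density[OF D] by simp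
  also have "\<dots> = prob {\<omega>\<in>space M. \<sigma> / ?v * (B s \<omega> - B r \<omega>) < -3}"
    using BM by (subst measure_distr) (auto intro!: arg_cong[where f = prob])
  also have "\<dots> \<le> prob {\<omega>\<in>space M. \<sigma> * (2 * (B s \<omega> - B r \<omega>)) < - 3 * sqrt s}"
  proof (rule finite_measure_mono)
    show "{\<omega>\<in>space M. \<sigma> / ?v * (B s \<omega> - B r \<omega>) < -3} \<subseteq> {\<omega>\<in>space M. \<sigma> * (2 * (B s \<omega> - B r \<omega>)) < - 3 * sqrt s}"
    proof safe
      fix \<omega> assume "\<sigma> / ?v * (B s \<omega> - B r \<omega>) < -3"
      then have "\<sigma> * (B s \<omega> - B r \<omega>) < - 3 * ?v" using v by (simp add: field_simps)
      then have "\<sigma> * (2 * (B s \<omega> - B r \<omega>)) < - 3 * (2 * ?v)" by (simp add: algebra_simps)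
      also have "\<dots> \<le> - 3 * sqrt s" using half by simp
      finally show "\<sigma> * (2 * (B s \<omega> - B r \<omega>)) < - 3 * sqrt s" .
    qed
    show "{\<omega>\<in>space M. \<sigma> * (2 * (B s \<omega> - B r \<omega>)) < - 3 * sqrt s} \<in> events" using BM by measurable
  qed
  finally show ?thesis .
qed

lemma brownian_chebyshev:
  assumes bm: "standard_brownian_motion F B" and "0 \<le> r" "0 < a"
  shows "prob {\<omega>\<in>space M. a \<le> \<bar>B r \<omega>\<bar>} \<le> r / a\<^sup>2"
proof -
  have B0: "\<And>\<omega>. \<omega> \<in> space M \<Longrightarrow> B 0 \<omega> = 0" using bm by (simp add: standard_brownian_motion_def)
  have m: "(\<lambda>_. 1) \<in> borel_measurable (F 0)" "integrable M (\<lambda>_. 1::real)" by auto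
  note mom = brownian_increment_moments(3,4)[OF bm order_refl \<open>0 \<le> r\<close> m]
  have int: "integrable M (\<lambda>\<omega>. (B r \<omega>)\<^sup>2)"
    using mom(1) by (subst Bochner_Integration.integrable_cong[OF refl]) (auto simp: B0)
  have ex: "expectation (\<lambda>\<omega>. (B r \<omega>)\<^sup>2) = r"
    using mom(2) by (subst Bochner_Integration.integral_cong[OF refl]) (auto simp: B0 prob_space)
  have "B r \<in> borel_measurable M"
    using brownian_measurable(1,3)[OF bm, of r] \<open>0 \<le> r\<close> by auto
  from second_moment_method[OF this int \<open>0 < a\<close>] show ?thesis by (simp add: ex)
qed

text \<open>
  By continuity of the paths, \<open>2 \<surd>R\<close> stays within \<open>\<surd>\<eta>\<close> of its initial value \<open>2\<close> up to time \<open>s\<close>, with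
  probability tending to \<open>1\<close> as \<open>s\<close> tends to \<open>0\<close>. The Ito integral therefore differs from \<open>2 B\<^sub>s\<close> by
  \<open>o(\<surd>s)\<close> in probability.
\<close>
lemma sqrt_diffusion_small_time_approximation:
  fixes R :: "real \<Rightarrow> 'a \<Rightarrow> real"
  assumes bm: "standard_brownian_motion F B"
    and adapted: "\<And>s. 0 \<le> s \<Longrightarrow> R s \<in> borel_measurable (F s)"
    and cont: "\<And>\<omega>. \<omega> \<in> space M \<Longrightarrow> continuous_on {0..} (\<lambda>s. R s \<omega>)"
    and ito: "\<And>t. 0 \<le> t \<Longrightarrow> has_ito_integral F B (\<lambda>s \<omega>. 2 * sqrt (R s \<omega>)) t (J t)"
    and start: "AE \<omega> in M. R 0 \<omega> = 1"
  defines "s \<equiv> \<lambda>n. 1 / real (Suc n)"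
  shows "(\<lambda>n. prob {\<omega>\<in>space M. sqrt (s n) / 2 < \<bar>J (s n) \<omega> - 2 * B (s n) \<omega>\<bar>}) \<longlonglongrightarrow> 0"
proof (rule LIMSEQ_I)
  have s_pos: "0 < s n" for n by (simp add: s_def)
  have s_mono: "s m \<le> s n" if "n \<le> m" for m n using that by (simp add: s_def frac_le)
  have RM: "R u \<in> borel_measurable M" if "0 \<le> u" for u
    using brownian_measurable(1)[OF bm that adapted] that by auto
  fix e :: real assume "0 < e"
  \<comment> \<open>The Ito estimate at the level \<open>\<surd>s / 4\<close> costs \<open>4 \<eta> s / (\<surd>s / 4)\<^sup>2 = 64 \<eta>\<close>, whatever \<open>s\<close> is.\<close>
  define \<eta> where "\<eta> = e / 128"
  have "0 < \<eta>" using \<open>0 < e\<close> by (simp add: \<eta>_def)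
  define D where "D n = {\<omega>\<in>space M. \<forall>u\<in>{0..s n}. R u \<omega> \<in> {z. (2 * sqrt z - 2)\<^sup>2 \<le> \<eta>}}" for n
  have DM: "D n \<in> events" for n
    unfolding D_def
    by (intro sets_all_in_closed RM closed_Collect_le continuous_intros)
       (auto intro: continuous_on_subset[OF cont])
  have "incseq D"
  proof (rule monoI)
    fix m n :: nat assume "m \<le> n"
    from s_mono[OF this] show "D m \<le> D n" by (auto simp: D_def)
  qed
  then have "(\<lambda>n. prob (D n)) \<longlonglongrightarrow> prob (\<Union>n. D n)"
    using DM by (intro finite_Lim_measure_incseq) auto
  moreover have "prob (\<Union>n. D n) = 1"
  proof -
    have in_D: "\<exists>n. \<omega> \<in> D n" if \<omega>: "\<omega> \<in> space M" and R0: "R 0 \<omega> = 1" for \<omega>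
    proof -
      have "((\<lambda>u. (2 * sqrt (R u \<omega>) - 2)\<^sup>2) \<longlongrightarrow> (2 * sqrt (R 0 \<omega>) - 2)\<^sup>2) (at 0 within {0..})"
        using cont[OF \<omega>] by (intro tendsto_intros) (simp add: continuous_on)
      then have "\<forall>\<^sub>F u in at 0 within {0..}. (2 * sqrt (R u \<omega>) - 2)\<^sup>2 < \<eta>"
        using \<open>0 < \<eta>\<close> by (intro order_tendstoD(2)) (simp_all add: R0)
      then obtain d where d: "0 < d" "\<And>u. 0 \<le> u \<Longrightarrow> u \<noteq> 0 \<Longrightarrow> u < d \<Longrightarrow> (2 * sqrt (R u \<omega>) - 2)\<^sup>2 < \<eta>"
        by (auto simp: eventually_at dist_real_def)
      obtain n where n: "s n < d"
        using reals_Archimedean[OF d(1)] by (auto simp: s_def inverse_eq_divide)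
      have "(2 * sqrt (R u \<omega>) - 2)\<^sup>2 \<le> \<eta>" if "u \<in> {0..s n}" for u
        using d(2)[of u] that n R0 \<open>0 < \<eta>\<close> by (cases "u = 0") auto
      then show ?thesis using \<omega> unfolding D_def by blast
    qed
    from start AE_space have "AE \<omega> in M. \<omega> \<in> (\<Union>n. D n)"
      by eventually_elim (use in_D in blast)
    then show ?thesis using DM by (subst prob_eq_1) auto
  qed
  ultimately have "\<forall>\<^sub>F n in sequentially. 1 - e / 4 < prob (D n)"
    using \<open>0 < e\<close> by (intro order_tendstoD(1)) auto
  then obtain N where N: "\<And>n. N \<le> n \<Longrightarrow> 1 - e / 4 < prob (D n)"
    by (auto simp: eventually_sequentially)
  have "prob {\<omega>\<in>space M. sqrt (s n) / 2 < \<bar>J (s n) \<omega> - 2 * B (s n) \<omega>\<bar>} < e" if "N \<le> n" for n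
  proof -
    have "prob {\<omega>\<in>space M. 2 * (sqrt (s n) / 4) < \<bar>J (s n) \<omega> - 2 * B (s n) \<omega>\<bar>}
        \<le> 4 * \<eta> * s n / (sqrt (s n) / 4)\<^sup>2 + prob (space M - D n)"
      by (rule ito_integral_near_constant[OF bm ito]) (use s_pos[of n] \<open>0 < \<eta>\<close> DM in \<open>auto simp: D_def\<close>)
    also have "4 * \<eta> * s n / (sqrt (s n) / 4)\<^sup>2 = e / 2"
      using s_pos[of n] by (simp add: power_divide \<eta>_def)
    also have "prob (space M - D n) < e / 4"
      using N[OF that] DM by (simp add: prob_compl)
    finally show ?thesis using \<open>0 < e\<close> by simp
  qed
  then show "\<exists>N. \<forall>n\<ge>N. norm (prob {\<omega>\<in>space M. sqrt (s n) / 2 < \<bar>J (s n) \<omega> - 2 * B (s n) \<omega>\<bar>} - 0) < e"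
    by (intro exI[of _ N]) auto
qed

text \<open>
  A Brownian increment of order \<open>\<surd>s\<close>, independent of the event, has the sign \<open>-\<sigma>\<close> with a probability
  bounded away from \<open>0\<close>, and it carries \<open>R\<^sub>s\<close> to the forbidden side of \<open>1\<close> as \<open>s\<close> tends to \<open>0\<close>.
  The constants are chosen such that \<open>2 \<sigma> (B\<^sub>s - B\<^sub>r) < -3 \<surd>s\<close> outweighs the sum of the remainder (at most
  \<open>\<surd>s / 2\<close>), of \<open>2 \<bar>B\<^sub>r\<bar>\<close> (less than \<open>\<surd>s / 2\<close>) and of the drift (at most \<open>\<surd>s\<close>).
\<close>
lemma besq_one_sided_null:
  fixes R :: "real \<Rightarrow> 'a \<Rightarrow> real"
  assumes bm: "standard_brownian_motion F B"
    and adapted: "\<And>s. 0 \<le> s \<Longrightarrow> R s \<in> borel_measurable (F s)"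
    and cont: "\<And>\<omega>. \<omega> \<in> space M \<Longrightarrow> continuous_on {0..} (\<lambda>s. R s \<omega>)"
    and ito: "\<And>t. 0 \<le> t \<Longrightarrow> has_ito_integral F B (\<lambda>s \<omega>. 2 * sqrt (R s \<omega>)) t
                  (\<lambda>\<omega>. R t \<omega> - R 0 \<omega> - 2 * (\<mu> + 1) * t)"
    and start: "AE \<omega> in M. R 0 \<omega> = 1"
    and \<sigma>: "\<sigma> \<in> {-1, 1}"
  shows "AE \<omega> in M. \<not> (\<exists>n. \<forall>u\<in>{0..1 / real (Suc n)}. 0 \<le> \<sigma> * (R u \<omega> - 1))"
proof -
  define s where "s n = 1 / real (Suc n)" for n
  define E where "E n = {\<omega>\<in>space M. \<forall>u\<in>{0..s n}. R u \<omega> \<in> {z. 0 \<le> \<sigma> * (z - 1)}}" for n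
  define Germ where "Germ = (\<Union>n. E n)"
  have s_pos: "0 < s n" for n by (simp add: s_def)
  have s_0: "s \<longlonglongrightarrow> 0"
    unfolding s_def using LIMSEQ_inverse_real_of_nat by (simp add: inverse_eq_divide)
  have s_mono: "s m \<le> s n" if "n \<le> m" for m n using that by (simp add: s_def frac_le)
  have s_sq: "s n * s n \<le> s n" for n using s_mono[of 0 n] s_pos[of n] mult_left_le[of "s n" "s n"] by (simp add: s_def)
  have spaceF: "space (F r) = space M" for r by (rule brownian_measurable(4)[OF bm])
  have adapted_later: "R u \<in> borel_measurable (F r)" if "0 \<le> u" "u \<le> r" for u r
    using brownian_measurable(2)[OF bm that adapted] that by auto
  have RM: "R u \<in> borel_measurable M" if "0 \<le> u" for u
    using brownian_measurable(1)[OF bm that adapted] that by auto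
  have BM: "B u \<in> borel_measurable M" if "0 \<le> u" for u
    using brownian_measurable(1,3)[OF bm that] by auto
  have E_F: "E n \<in> sets (F (s n))" for n
  proof -
    have "{\<omega>\<in>space (F (s n)). \<forall>u\<in>{0..s n}. R u \<omega> \<in> {z. 0 \<le> \<sigma> * (z - 1)}} \<in> sets (F (s n))"
      by (intro sets_all_in_closed adapted_later closed_Collect_le continuous_intros)
         (auto simp: spaceF intro: continuous_on_subset[OF cont])
    then show ?thesis by (simp add: E_def spaceF)
  qed
  have E_incseq: "incseq E"
  proof (rule monoI)
    fix m n :: nat assume "m \<le> n"
    from s_mono[OF this] show "E m \<le> E n" by (auto simp: E_def)
  qed
  \<comment> \<open>The union is increasing, so any finite number of its members may be dropped.\<close>
  have Germ_F: "Germ \<in> sets (F r)" if "0 < r" for r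
  proof -
    obtain N where N: "s N < r"
      using reals_Archimedean[OF \<open>0 < r\<close>] by (auto simp: s_def inverse_eq_divide)
    have "Germ = (\<Union>n. E (n + N))"
      unfolding Germ_def using incseqD[OF E_incseq, of n "n + N" for n] by fastforce
    moreover have "E (n + N) \<in> sets (F r)" for n
      using E_F[of "n + N"] brownian_measurable(5)[OF bm, of "s (n + N)" r] s_pos[of "n + N"] s_mono[of N "n + N"] N
      by auto
    ultimately show ?thesis by auto
  qed
  have EM: "E n \<in> events" for n using E_F brownian_measurable(6)[OF bm, of "s n"] s_pos[of n] by auto
  then have GM: "Germ \<in> events" by (auto simp: Germ_def)

  define miss where "miss n = prob (Germ - E n)" for n
  have miss: "miss \<longlonglongrightarrow> 0"
  proof -
    have "(\<lambda>n. prob (E n)) \<longlonglongrightarrow> prob Germ"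
      unfolding Germ_def using EM by (intro finite_Lim_measure_incseq E_incseq) auto
    then have "(\<lambda>n. prob Germ - prob (E n)) \<longlonglongrightarrow> prob Germ - prob Germ" by (intro tendsto_intros)
    moreover have "miss = (\<lambda>n. prob Germ - prob (E n))"
      unfolding miss_def using EM GM by (intro ext finite_measure_Diff) (auto simp: Germ_def)
    ultimately show ?thesis by simp
  qed

  define J where "J n \<omega> = R (s n) \<omega> - R 0 \<omega> - 2 * (\<mu> + 1) * s n" for n \<omega>
  have JM: "J n \<in> borel_measurable M" for n
    unfolding J_def[abs_def] using RM[of "s n"] RM[of 0] s_pos[of n] by auto
  define remainder where "remainder n = prob {\<omega>\<in>space M. sqrt (s n) / 2 < \<bar>J n \<omega> - 2 * B (s n) \<omega>\<bar>}" for n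
  have remainder: "remainder \<longlonglongrightarrow> 0"
    unfolding remainder_def[abs_def] J_def[abs_def] s_def
    by (rule sqrt_diffusion_small_time_approximation[OF bm adapted cont ito start])

  \<comment> \<open>The time \<open>s\<^sup>2\<close> separates the scales: \<open>B\<close> is of order \<open>s\<close> there, against \<open>\<surd>s\<close> at time \<open>s\<close>.\<close>
  define early where "early n = prob {\<omega>\<in>space M. sqrt (s n) / 4 \<le> \<bar>B (s n * s n) \<omega>\<bar>}" for n
  have early: "early \<longlonglongrightarrow> 0"
  proof (rule tendsto_sandwich[OF _ _ tendsto_const])
    show "(\<lambda>n. 16 * s n) \<longlonglongrightarrow> 0" using tendsto_mult_left[OF s_0, of 16] by simp
    show "\<forall>\<^sub>F n in sequentially. early n \<le> 16 * s n"
    proof (rule always_eventually, rule allI)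
      fix n
      have "early n \<le> s n * s n / (sqrt (s n) / 4)\<^sup>2"
        unfolding early_def using s_pos[of n] by (intro brownian_chebyshev[OF bm]) auto
      also have "\<dots> = 16 * s n" using s_pos[of n] by (simp add: power_divide)
      finally show "early n \<le> 16 * s n" .
    qed
  qed (simp add: early_def)

  have "(\<lambda>n. sqrt (s n)) \<longlonglongrightarrow> sqrt 0" by (intro tendsto_intros s_0)
  then have "(\<lambda>n. 2 * (\<mu> + 1) * sqrt (s n)) \<longlonglongrightarrow> 2 * (\<mu> + 1) * 0" by (intro tendsto_intros) simp
  then have "\<forall>\<^sub>F n in sequentially. \<bar>2 * (\<mu> + 1) * sqrt (s n)\<bar> < 1"
    by (intro order_tendstoD(2)[OF tendsto_rabs]) auto
  moreover have "\<forall>\<^sub>F n in sequentially. s n < 3 / 4" by (intro order_tendstoD(2)[OF s_0]) simp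
  ultimately have "\<forall>\<^sub>F n in sequentially. prob Germ * normal_tail \<le> miss n + (remainder n + early n)"
  proof eventually_elim
    case (elim n)
    let ?q = "sqrt (s n)" and ?r = "s n * s n"
    let ?inc = "{\<omega>\<in>space M. B (s n) \<omega> - B ?r \<omega> \<in> {x. \<sigma> * (2 * x) < - 3 * ?q}}"
    have r: "0 < ?r" "4 * ?r \<le> 3 * s n" "?r < s n"
      using s_pos[of n] elim(2) mult_strict_left_mono[of "s n" "3/4" "s n"] by auto
    have [measurable]: "J n \<in> borel_measurable M" "B (s n) \<in> borel_measurable M" "B ?r \<in> borel_measurable M"
      "Germ \<in> events" "E n \<in> events"
      using JM BM s_pos[of n] r(1) GM EM by auto
    have drift: "\<bar>2 * (\<mu> + 1) * s n\<bar> \<le> ?q"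
    proof -
      have "\<bar>2 * (\<mu> + 1) * s n\<bar> = \<bar>2 * (\<mu> + 1) * ?q\<bar> * ?q"
        using s_pos[of n] by (simp add: abs_mult)
      also have "\<dots> \<le> 1 * ?q" using elim(1) s_pos[of n] by (intro mult_right_mono) auto
      finally show ?thesis by simp
    qed
    have [measurable]: "{x. \<sigma> * (2 * x) < - 3 * ?q} \<in> sets borel" by measurable
    have "prob Germ * normal_tail \<le> prob Germ * prob ?inc"
      using brownian_increment_tail[OF bm _ r(2) s_pos \<sigma>] r(1) by (intro mult_left_mono) auto
    also have "\<dots> = prob (Germ \<inter> ?inc)"
      using r by (intro brownian_increment_indep[OF bm _ _ Germ_F, symmetric]) auto
    also have "\<dots> \<le> prob ((Germ - E n) \<union> ({\<omega>\<in>space M. ?q / 2 < \<bar>J n \<omega> - 2 * B (s n) \<omega>\<bar>} \<union>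
        {\<omega>\<in>space M. ?q / 4 \<le> \<bar>B ?r \<omega>\<bar>}))"
    proof (rule finite_measure_mono_AE)
      show "AE \<omega> in M. \<omega> \<in> Germ \<inter> ?inc \<longrightarrow> \<omega> \<in> (Germ - E n) \<union> ({\<omega>\<in>space M. ?q / 2 < \<bar>J n \<omega> - 2 * B (s n) \<omega>\<bar>} \<union>
        {\<omega>\<in>space M. ?q / 4 \<le> \<bar>B ?r \<omega>\<bar>})"
        using start
      proof eventually_elim
        case (elim \<omega>)
        show ?case
        proof (intro impI, rule ccontr)
          assume in_inc: "\<omega> \<in> Germ \<inter> ?inc"
            and no: "\<omega> \<notin> (Germ - E n) \<union> ({\<omega>\<in>space M. ?q / 2 < \<bar>J n \<omega> - 2 * B (s n) \<omega>\<bar>} \<union>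
              {\<omega>\<in>space M. ?q / 4 \<le> \<bar>B ?r \<omega>\<bar>})"
          have "0 \<le> \<sigma> * (R (s n) \<omega> - 1)" using in_inc no s_pos[of n] by (auto simp: E_def)
          moreover have "\<bar>J n \<omega> - 2 * B (s n) \<omega>\<bar> \<le> ?q / 2" "\<bar>B ?r \<omega>\<bar> < ?q / 4"
            "\<sigma> * (2 * (B (s n) \<omega> - B ?r \<omega>)) < - 3 * ?q"
            using in_inc no by auto
          moreover have "R (s n) \<omega> - 1 = J n \<omega> + 2 * (\<mu> + 1) * s n" using elim by (simp add: J_def)
          moreover have "0 < ?q" using s_pos[of n] by simp
          ultimately show False using \<sigma> drift by auto
        qed
      qed
      show "(Germ - E n) \<union> ({\<omega>\<in>space M. ?q / 2 < \<bar>J n \<omega> - 2 * B (s n) \<omega>\<bar>} \<union>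
        {\<omega>\<in>space M. ?q / 4 \<le> \<bar>B ?r \<omega>\<bar>}) \<in> events"
        by measurable
    qed
    also have "\<dots> \<le> miss n + (remainder n + early n)"
      unfolding miss_def remainder_def early_def
      by (intro order_trans[OF measure_Un_le] add_left_mono measure_Un_le) measurable
    finally show ?case .
  qed
  moreover have "(\<lambda>n. miss n + (remainder n + early n)) \<longlonglongrightarrow> 0 + (0 + 0)"
    by (intro tendsto_add miss remainder early)
  ultimately have "prob Germ * normal_tail \<le> 0"
    using tendsto_lowerbound[of _ "0::real" sequentially] by simp
  then have "prob Germ = 0"
    using normal_tail_pos measure_nonneg[of M Germ] by (auto simp: mult_le_0_iff)
  then have "AE \<omega> in M. \<omega> \<notin> Germ" using GM by (simp add: prob_eq_0)
  then show ?thesis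
    by (rule AE_mp) (auto intro!: AE_I2 simp: Germ_def E_def s_def)
qed

section \<open>Conditioning an almost sure event\<close>

text \<open>
  The indicator of \<open>A\<close> is almost surely the constant \<open>1\<close>, which is its own conditional expectation, and
  intersecting with \<open>A\<close> changes no probability.
\<close>
lemma cond_prob_of_almost_sure_event:
  assumes A: "A \<in> events" "prob A = 1" and X: "X \<in> borel_measurable M"
  shows "\<exists>g. cond_prob_version A X g"
    and "cond_prob_version A X g \<Longrightarrow> AE x in distr M borel X. g x = 1"
    and "has_cond_prob_at A X x 1"
proof -
  let ?F = "vimage_algebra (space M) X borel"
  have sub: "subalgebra M ?F"
    using X by (auto simp: subalgebra_def sets_vimage_algebra2 measurable_sets)
  interpret F: finite_measure_subalgebra M ?F
    using sub by unfold_locales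
  have in_A: "AE \<omega> in M. \<omega> \<in> A" using A by (simp add: prob_eq_1)
  have "AE \<omega> in M. real_cond_exp M ?F (indicator A) \<omega> = real_cond_exp M ?F (\<lambda>_. 1) \<omega>"
    using A in_A by (intro F.real_cond_exp_cong) (auto elim: eventually_mono)
  moreover have "AE \<omega> in M. real_cond_exp M ?F (\<lambda>_. 1) \<omega> = 1"
    by (intro F.real_cond_exp_F_meas) auto
  ultimately have one: "AE \<omega> in M. real_cond_exp M ?F (indicator A) \<omega> = 1"
    by eventually_elim simp
  then show "\<exists>g. cond_prob_version A X g"
    by (intro exI[of _ "\<lambda>_. 1"]) (simp add: cond_prob_version_def)
  show "AE x in distr M borel X. g x = 1" if "cond_prob_version A X g"
  proof -
    have [measurable]: "g \<in> borel_measurable borel" using that by (simp add: cond_prob_version_def)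
    have "AE \<omega> in M. real_cond_exp M ?F (indicator A) \<omega> = g (X \<omega>)"
      using that by (simp add: cond_prob_version_def)
    with one have "AE \<omega> in M. g (X \<omega>) = 1" by eventually_elim simp
    then show ?thesis using X by (subst AE_distr_iff) auto
  qed
  have "prob {\<omega>\<in>A. \<bar>X \<omega> - x\<bar> < r} = prob {\<omega>\<in>space M. \<bar>X \<omega> - x\<bar> < r}" for r
  proof (rule finite_measure_eq_AE)
    show "{\<omega>\<in>A. \<bar>X \<omega> - x\<bar> < r} \<in> events" "{\<omega>\<in>space M. \<bar>X \<omega> - x\<bar> < r} \<in> events"
      using A X by measurable
    show "AE \<omega> in M. (\<omega> \<in> {\<omega>\<in>A. \<bar>X \<omega> - x\<bar> < r}) = (\<omega> \<in> {\<omega>\<in>space M. \<bar>X \<omega> - x\<bar> < r})"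
      using in_A by (auto elim: eventually_mono)
  qed
  then show "has_cond_prob_at A X x 1"
    by (simp add: has_cond_prob_at_def)
qed

end

theorem corollary4p3:
  fixes M :: "'a measure" and \<mu> t :: real and R :: "real \<Rightarrow> 'a \<Rightarrow> real"
  assumes "prob_space M"
    and "\<mu> \<ge> 0"
    and "prob_space.squared_bessel M \<mu> R"
    and "t > 0"
    and "AE \<omega> in M. R 0 \<omega> = 1"
  defines "A \<equiv> {\<omega>\<in>space M. hitting_time R 1 \<omega> \<le> ereal t}"
  shows "(\<exists>g. prob_space.cond_prob_version M A (R t) g) \<and>
         (\<forall>g. prob_space.cond_prob_version M A (R t) g \<longrightarrow>
            (AE x in distr M borel (R t). 1 \<le> x \<longrightarrow> g x = 1)) \<and>
         (\<forall>x\<ge>1. prob_space.has_cond_prob_at M A (R t) x 1)"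
proof -
  interpret prob_space M by fact
  obtain F B where bm: "standard_brownian_motion F B"
    and adapted: "\<And>s. 0 \<le> s \<Longrightarrow> R s \<in> borel_measurable (F s)"
    and cont: "\<And>\<omega>. \<omega> \<in> space M \<Longrightarrow> continuous_on {0..} (\<lambda>s. R s \<omega>)"
    and ito: "\<And>t. 0 \<le> t \<Longrightarrow> has_ito_integral F B (\<lambda>s \<omega>. 2 * sqrt (R s \<omega>)) t
                  (\<lambda>\<omega>. R t \<omega> - R 0 \<omega> - 2 * (\<mu> + 1) * t)"
    using assms(3) unfolding squared_bessel_def by blast
  have RM: "R u \<in> borel_measurable M" if "0 \<le> u" for u
    using brownian_measurable(1)[OF bm that adapted] that by auto
  have A_iff: "\<omega> \<in> A \<longleftrightarrow> (\<exists>n. \<exists>u\<in>{1 / real (Suc n)..t}. R u \<omega> = 1)" if "\<omega> \<in> space M" for \<omega>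
    using hitting_time_le_iff[where R = R and \<omega> = \<omega> and y = 1, OF cont[OF that] \<open>t > 0\<close>] that by (simp add: A_def)
  have "A = (\<Union>n. {\<omega>\<in>space M. \<exists>u\<in>{1 / real (Suc n)..t}. R u \<omega> = 1})"
    using A_iff by (auto simp: A_def)
  moreover have "{\<omega>\<in>space M. \<exists>u\<in>{1 / real (Suc n)..t}. R u \<omega> = 1} \<in> events" for n
    by (intro sets_hits_value RM continuous_on_subset[OF cont])
       (auto intro: order_trans[of 0 "1 / real (Suc n)"])
  ultimately have A_M: "A \<in> events" by auto
  have null: "AE \<omega> in M. \<not> (\<exists>n. \<forall>u\<in>{0..1 / real (Suc n)}. 0 \<le> \<sigma> * (R u \<omega> - 1))" if "\<sigma> \<in> {-1, 1}" for \<sigma>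
    by (rule besq_one_sided_null[OF bm adapted cont ito \<open>AE \<omega> in M. R 0 \<omega> = 1\<close> that])
  have above: "AE \<omega> in M. \<not> (\<exists>n. \<forall>u\<in>{0..1 / real (Suc n)}. 0 \<le> 1 * (R u \<omega> - 1))"
    and below: "AE \<omega> in M. \<not> (\<exists>n. \<forall>u\<in>{0..1 / real (Suc n)}. 0 \<le> - 1 * (R u \<omega> - 1))"
    by (intro null; simp)+
  have "AE \<omega> in M. \<omega> \<in> A"
    using above below \<open>AE \<omega> in M. R 0 \<omega> = 1\<close> AE_space
  proof eventually_elim
    case (elim \<omega>)
    show ?case
    proof (rule ccontr)
      assume "\<omega> \<notin> A"
      then have no: "R u \<omega> \<noteq> 1" if "0 < u" "u \<le> t" for u
      proof -
        obtain n where "inverse (real (Suc n)) < u" using reals_Archimedean \<open>0 < u\<close> by blast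
        then have "u \<in> {1 / real (Suc n)..t}" using \<open>u \<le> t\<close> by (simp add: inverse_eq_divide)
        then show ?thesis using A_iff elim(4) \<open>\<omega> \<notin> A\<close> by blast
      qed
      obtain n where n: "1 / real (Suc n) < t"
        using reals_Archimedean[OF \<open>t > 0\<close>] by (auto simp: inverse_eq_divide)
      have path: "continuous_on {u..v} (\<lambda>s. R s \<omega>)" if "0 \<le> u" for u v
        using that by (intro continuous_on_subset[OF cont[OF elim(4)]]) auto
      \<comment> \<open>By the intermediate value theorem the path has stayed on the side of \<open>1\<close> where it is at time \<open>t\<close>.\<close>
      show False
      proof (cases "1 \<le> R t \<omega>")
        case True
        have "1 \<le> R u \<omega>" if "0 < u" "u \<le> t" for u
        proof (rule ccontr)
          assume "\<not> 1 \<le> R u \<omega>"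
          then obtain v where "u \<le> v" "v \<le> t" "R v \<omega> = 1"
            using IVT'[of "\<lambda>s. R s \<omega>" u 1 t] True path[of u t] \<open>0 < u\<close> \<open>u \<le> t\<close> by auto
          then show False using no[of v] that by simp
        qed
        then have "0 \<le> 1 * (R u \<omega> - 1)" if "u \<in> {0..1 / real (Suc n)}" for u
          using that n elim(3) by (cases "u = 0") auto
        then have "\<forall>u\<in>{0..1 / real (Suc n)}. 0 \<le> 1 * (R u \<omega> - 1)" by blast
        with elim(1) show False by blast
      next
        case False
        have "R u \<omega> \<le> 1" if "0 < u" "u \<le> t" for u
        proof (rule ccontr)
          assume "\<not> R u \<omega> \<le> 1"
          then obtain v where "u \<le> v" "v \<le> t" "R v \<omega> = 1"
            using IVT2'[of "\<lambda>s. R s \<omega>" t 1 u] False path[of u t] \<open>0 < u\<close> \<open>u \<le> t\<close> by auto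
          then show False using no[of v] that by simp
        qed
        then have "0 \<le> - 1 * (R u \<omega> - 1)" if "u \<in> {0..1 / real (Suc n)}" for u
          using that n elim(3) by (cases "u = 0") auto
        then have "\<forall>u\<in>{0..1 / real (Suc n)}. 0 \<le> - 1 * (R u \<omega> - 1)" by blast
        with elim(2) show False by blast
      qed
    qed
  qed
  then have "prob A = 1" using A_M by (simp add: prob_eq_1)
  note sure = cond_prob_of_almost_sure_event[OF A_M this RM]
  have Rt: "0 \<le> t" using \<open>t > 0\<close> by simp
  have "AE x in distr M borel (R t). 1 \<le> x \<longrightarrow> g x = 1" if "cond_prob_version A (R t) g" for g
    using sure(2)[OF Rt that] by (rule eventually_mono) simp
  then show ?thesis using sure(1,3)[OF Rt] by blast
qed

end
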